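(* Let $n\in\mathbb{N}$ and let $\varphi : [n]^{\omega}\to\{0,1\}^{\omega}$ be a Sperner colouring, i.e. a mapping such that $\varphi(\sigma)\neq\varphi(\sigma')$ whenever $\sigma,\sigma'\in[n]^\omega$ satisfy $\|\sigma-\sigma'\| = n$. Then there is $\sigma\in[n]^{\omega}$ such that $\varphi(K_{\sigma})$ is infinite.
   Context: $[n]$ denotes the set $\{0,1,\ldots,n\}$ of integers (where $n$ is a positive integer), and $[n]^{\omega}$ is the set of all sequences $\sigma:\omega\to[n]$. For $\sigma,\tau\in[n]^\omega$, $\|\sigma-\tau\| = \sup\{|\sigma(i)-\tau(i)| : i\in\omega\}$. The sum of two elements $\sigma,\tau\in[n]^\omega$ is understood relative to $[n]$: $(\sigma+\tau)(i)=\min(n,\sigma(i)+\tau(i))$ for all $i$. For $\sigma\in[n]^\omega$, the (positive) cube with index $\sigma$ is $K_\sigma = \{\sigma+\tau : \tau\in\{0,1\}^\omega\}\subset[n]^\omega$, and $\varphi(K_\sigma)$ denotes its image under $\varphi$. *)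

theory Defs
  imports Complex_Main "HOL-Library.FuncSet"
begin

definition seqs :: "nat \<Rightarrow> (nat \<Rightarrow> int) set" where
  "seqs n = UNIV \<rightarrow> {0..int n}"

text \<open>
  The supremum is taken in the conditionally complete order of the integers; for two
  elements of \<^term>\<open>seqs n\<close> the set of distances is nonempty and bounded above by \<open>n\<close>,
  so it is the true supremum there.
\<close>
definition seq_dist :: "(nat \<Rightarrow> int) \<Rightarrow> (nat \<Rightarrow> int) \<Rightarrow> int" where
  "seq_dist \<sigma> \<tau> = (SUP i. \<bar>\<sigma> i - \<tau> i\<bar>)"

definition trunc_add :: "nat \<Rightarrow> (nat \<Rightarrow> int) \<Rightarrow> (nat \<Rightarrow> int) \<Rightarrow> (nat \<Rightarrow> int)" where
  "trunc_add n \<sigma> \<tau> = (\<lambda>i. min (int n) (\<sigma> i + \<tau> i))"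

definition cube :: "nat \<Rightarrow> (nat \<Rightarrow> int) \<Rightarrow> (nat \<Rightarrow> int) set" where
  "cube n \<sigma> = {trunc_add n \<sigma> \<tau> | \<tau>. \<tau> \<in> UNIV \<rightarrow> {0, 1}}"

definition sperner_colouring :: "nat \<Rightarrow> ((nat \<Rightarrow> int) \<Rightarrow> (nat \<Rightarrow> int)) \<Rightarrow> bool" where
  "sperner_colouring n \<phi> \<longleftrightarrow>
     \<phi> \<in> seqs n \<rightarrow> (UNIV \<rightarrow> {0, 1}) \<and>
     (\<forall>\<sigma>\<in>seqs n. \<forall>\<sigma>'\<in>seqs n. seq_dist \<sigma> \<sigma>' = int n \<longrightarrow> \<phi> \<sigma> \<noteq> \<phi> \<sigma>')"

end

theory Submission
  imports Defs "HOL-Library.Nat_Bijection" "HOL-Library.Countable" "HOL-Library.Infinite_Set"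
begin

text \<open>
  Suppose that every cube has finitely many colours. The points that matter come from
  \<open>n\<close>-tuples of functions \<open>nat \<Rightarrow> nat\<close>: with the coordinates coded as pairs \<open>(i, v)\<close>,
  a tuple gives the sequence whose value at \<open>(i, v)\<close> is the number of entries \<open>f\<close> of the tuple
  with \<open>v < f i\<close>. Two features of this family are used.

  First, let \<open>0 \<le> a\<^sub>1 \<le> \<dots> \<le> a\<^sub>n\<close> pointwise. All tuples with \<open>a\<^sub>j\<^sub>-\<^sub>1 \<le> y\<^sub>j \<le> a\<^sub>j\<close> (where
  \<open>a\<^sub>0 = 0\<close>) give points of one cube, because the regions between the graphs of \<open>a\<^sub>j\<^sub>-\<^sub>1\<close> and
  \<open>a\<^sub>j\<close> are disjoint (\<open>ladder_subset_cube\<close>). So they have finitely many colours. Secondly, if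
  in some column \<open>i\<close> every entry of one tuple exceeds every entry of another, then the
  two points have distance \<open>n\<close>, and their colours differ.

  These are played against each other in a game. One player chooses \<open>p\<^sub>1\<close>, the other
  \<open>b\<^sub>1 \<ge> p\<^sub>1\<close>, the first \<open>p\<^sub>2 \<ge> b\<^sub>1\<close>, the other \<open>b\<^sub>2 \<ge> p\<^sub>2\<close>, and so on, where the functions
  of round \<open>j\<close> must begin with a fixed finite list \<open>s\<^sub>j\<close> of values. The first player wins
  for a set \<open>C\<close> of colours if all tuples with \<open>p\<^sub>j \<le> y\<^sub>j \<le> b\<^sub>j\<close> have colours in \<open>C\<close>. The claim
  is that for suitable \<open>s\<^sub>1, \<dots>, s\<^sub>n\<close> the first player wins for a finite \<open>C\<close>
  (\<open>ladder_confined\<close>). This refutes the colouring: the other player may start with \<open>b\<^sub>1\<close>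
  arbitrarily large in the column after \<open>s\<^sub>1\<close>, and so produces infinitely many
  tuples that lie pairwise at distance \<open>n\<close> and yet have colours in \<open>C\<close> (\<open>confined_play_above\<close>).

  The claim is proved from the last round back to the first. When a round is added in front,
  each bound \<open>b\<close> comes with its own lists \<open>s\<^sub>j\<close> and its own finite set of colours, and both
  have to be made independent of \<open>b\<close>. Since winning against \<open>b\<close> implies winning against
  every smaller bound, countably many pieces of data (the lists and the number of colours)
  can be fixed for all \<open>b\<close> that start with a long enough initial part of the lower bound:
  otherwise there are counterexamples \<open>b\<^sub>0, b\<^sub>1, \<dots>\<close> agreeing with it on longer and longer
  initial parts, so that the sequence has a pointwise upper bound, and this upper bound
  has no data at all (\<open>uniform_on_neighbourhood\<close>). Once the number of colours is bounded,
  the minimal sets of colours grow with \<open>b\<close> and are bounded in size, hence constant from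
  some \<open>b\<close> on, and the constant set serves for all \<open>b\<close> (\<open>uniform_finite_set\<close>).
\<close>

section \<open>Points from tuples of functions\<close>

definition subgraph_count :: "(nat \<Rightarrow> nat) list \<Rightarrow> nat \<Rightarrow> int" where
  "subgraph_count fs m = (\<Sum>f\<leftarrow>fs. of_bool (snd (prod_decode m) < f (fst (prod_decode m))))"

lemma subgraph_count_Nil [simp]: "subgraph_count [] m = 0"
  by (simp add: subgraph_count_def)

lemma subgraph_count_Cons: "subgraph_count (f # fs) m = of_bool (snd (prod_decode m) < f (fst (prod_decode m))) + subgraph_count fs m"
  by (simp add: subgraph_count_def)

lemma subgraph_count_encode_Cons [simp]: "subgraph_count (f # fs) (prod_encode (i, v)) = of_bool (v < f i) + subgraph_count fs (prod_encode (i, v))"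
  by (simp add: subgraph_count_Cons)

lemma subgraph_count_bounds: "0 \<le> subgraph_count fs m \<and> subgraph_count fs m \<le> int (length fs)"
  by (induction fs) (auto simp: subgraph_count_Cons)

lemma subgraph_count_in_seqs: "length fs = n \<Longrightarrow> subgraph_count fs \<in> seqs n"
  using subgraph_count_bounds by (auto simp: seqs_def)

lemma subgraph_count_eq_0: "(\<And>f. f \<in> set fs \<Longrightarrow> f i \<le> v) \<Longrightarrow> subgraph_count fs (prod_encode (i, v)) = 0"
  by (induction fs) (auto simp: not_less)

lemma subgraph_count_eq_length: "(\<And>f. f \<in> set fs \<Longrightarrow> v < f i) \<Longrightarrow> subgraph_count fs (prod_encode (i, v)) = int (length fs)"
  by (induction fs) auto

lemma seq_dist_eq_max:
  assumes "\<sigma> \<in> seqs n" "\<tau> \<in> seqs n" "\<bar>\<sigma> i - \<tau> i\<bar> = int n"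
  shows "seq_dist \<sigma> \<tau> = int n"
  unfolding seq_dist_def
proof (rule cSup_eq_maximum)
  show "int n \<in> range (\<lambda>i. \<bar>\<sigma> i - \<tau> i\<bar>)"
    by (rule range_eqI[of _ _ i]) (simp add: assms(3))
  have bounds: "0 \<le> \<sigma> j \<and> \<sigma> j \<le> int n \<and> 0 \<le> \<tau> j \<and> \<tau> j \<le> int n" for j
    using assms(1,2) by (simp add: seqs_def Pi_iff)
  have "\<bar>\<sigma> j - \<tau> j\<bar> \<le> int n" for j
    using bounds[of j] by linarith
  then show "x \<le> int n" if "x \<in> range (\<lambda>i. \<bar>\<sigma> i - \<tau> i\<bar>)" for x
    using that by blast
qed

section \<open>Tuples between consecutive bounds\<close>

text \<open>
  Tuples are stored with the most recently chosen entry first; the order of the entries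
  does not affect the point of \<open>[n]\<^sup>\<omega>\<close> that they determine.
\<close>

definition slab :: "(nat \<Rightarrow> nat) list set \<Rightarrow> (nat \<Rightarrow> nat) \<Rightarrow> (nat \<Rightarrow> nat) \<Rightarrow> (nat \<Rightarrow> nat) list set" where
  "slab X p b = {y # ys |y ys. ys \<in> X \<and> p \<le> y \<and> y \<le> b}"

lemma slab_mono: "X \<subseteq> X' \<Longrightarrow> p' \<le> p \<Longrightarrow> b \<le> b' \<Longrightarrow> slab X p b \<subseteq> slab X' p' b'"
  unfolding slab_def by (blast intro: order_trans)

inductive ladder :: "nat \<Rightarrow> (nat \<Rightarrow> nat) list set \<Rightarrow> (nat \<Rightarrow> nat) \<Rightarrow> bool" where
  ladder_Nil: "ladder 0 {[]} (\<lambda>_. 0)"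
| ladder_step: "ladder j X a \<Longrightarrow> a \<le> b \<Longrightarrow> ladder (Suc j) (slab X a b) b"

text \<open>
  The base point of the cube is given by the tuple of lower bounds. Replacing the lower
  bounds of a tuple by its entries raises the value at \<open>(i, v)\<close> once for each
  interval \<open>(lower bound, entry]\<close> in column \<open>i\<close> that contains \<open>v + 1\<close>, and consecutive
  intervals are disjoint. In the induction this takes the form that below \<open>a i\<close> the new entry
  and its lower bound contribute equally, while above \<open>a i\<close> the old entries contribute nothing.
\<close>

lemma ladder_base:
  assumes "ladder j X a"
  shows "\<exists>bs. length bs = j \<and> (\<forall>f\<in>set bs. f \<le> a) \<and>
    (\<forall>ys\<in>X. length ys = j \<and> (\<forall>f\<in>set ys. f \<le> a) \<and> (\<forall>m. subgraph_count ys m - subgraph_count bs m \<in> {0, 1}))"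
  using assms
proof induction
  case ladder_Nil
  then show ?case by simp
next
  case (ladder_step j X a b)
  then obtain bs where bs: "length bs = j" "\<forall>f\<in>set bs. f \<le> a"
    and X: "\<And>ys. ys \<in> X \<Longrightarrow> length ys = j \<and> (\<forall>f\<in>set ys. f \<le> a) \<and> (\<forall>m. subgraph_count ys m - subgraph_count bs m \<in> {0, 1})"
    by blast
  have diff: "subgraph_count (y # ys) m - subgraph_count (a # bs) m \<in> {0, 1}"
    if ys: "ys \<in> X" and y: "a \<le> y" "y \<le> b" for y ys m
  proof -
    obtain i v where m: "m = prod_encode (i, v)"
      by (metis prod_decode_inverse surj_pair)
    show ?thesis
    proof (cases "v < a i")
      case True
      then have "v < y i" using y(1) by (meson le_funD order_less_le_trans)
      then show ?thesis using True X[OF ys] by (simp add: m)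
    next
      case False
      have "subgraph_count ys m = 0" "subgraph_count bs m = 0"
        unfolding m using False X[OF ys] bs(2)
        by (auto intro!: subgraph_count_eq_0 dest!: bspec le_funD[where x = i])
      then show ?thesis using False by (auto simp: m)
    qed
  qed
  have "\<forall>f\<in>set (a # bs). f \<le> b"
    using bs(2) ladder_step.hyps(2) by (auto intro: order_trans)
  moreover have "length zs = Suc j \<and> (\<forall>f\<in>set zs. f \<le> b) \<and> (\<forall>m. subgraph_count zs m - subgraph_count (a # bs) m \<in> {0, 1})"
    if mem: "zs \<in> slab X a b" for zs
  proof -
    obtain y ys where zs: "zs = y # ys" "ys \<in> X" "a \<le> y" "y \<le> b"
      using mem by (auto simp: slab_def)
    have "\<forall>f\<in>set ys. f \<le> b"
      using X[OF zs(2)] ladder_step.hyps(2) by (auto intro: order_trans)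
    then show ?thesis
      using X[OF zs(2)] zs diff[OF zs(2-4)] by auto
  qed
  ultimately show ?case
    using bs(1) by (intro exI[of _ "a # bs"]) auto
qed

lemma ladder_subset_cube:
  assumes "ladder n X a"
  shows "\<exists>\<sigma>\<in>seqs n. subgraph_count ` X \<subseteq> cube n \<sigma>"
proof -
  obtain bs where bs: "length bs = n"
    and X: "\<And>ys. ys \<in> X \<Longrightarrow> length ys = n \<and> (\<forall>m. subgraph_count ys m - subgraph_count bs m \<in> {0, 1})"
    using ladder_base[OF assms] by blast
  have "subgraph_count ys \<in> cube n (subgraph_count bs)" if "ys \<in> X" for ys
  proof -
    have "subgraph_count ys = trunc_add n (subgraph_count bs) (\<lambda>m. subgraph_count ys m - subgraph_count bs m)"
      using subgraph_count_bounds[of ys] X[OF that] by (auto simp: trunc_add_def)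
    then show ?thesis
      using X[OF that] unfolding cube_def by blast
  qed
  then show ?thesis
    using subgraph_count_in_seqs[OF bs] by blast
qed

section \<open>The game\<close>

definition cylinder :: "nat list \<Rightarrow> (nat \<Rightarrow> nat) set" where
  "cylinder s = {f. \<forall>i<length s. f i = s ! i}"

lemma sup_in_cylinder: "f \<in> cylinder s \<Longrightarrow> g \<in> cylinder s \<Longrightarrow> sup f g \<in> cylinder s"
  by (simp add: cylinder_def)

text \<open>
  The game of the introduction, with \<open>X\<close> the set of tuples fixed in earlier rounds and \<open>a\<close>
  the last upper bound. The first player must answer before the upper bound \<open>b\<close>, but then confines
  all entries in \<open>[p, b]\<close> at once: the later moves depend on \<open>b\<close> only, not on the entry.
  Both players being tied to the same list \<open>s\<close> is what makes two strategies of the first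
  player combinable; without it, a larger \<open>p\<close> would allow bounds \<open>b\<close> outside the
  domain of the original strategy.
\<close>

fun confined :: "((nat \<Rightarrow> nat) list \<Rightarrow> 'c) \<Rightarrow> nat list list \<Rightarrow> 'c set \<Rightarrow> (nat \<Rightarrow> nat) list set \<Rightarrow> (nat \<Rightarrow> nat) \<Rightarrow> bool"
where
  "confined c [] C X a = (\<forall>ys\<in>X. c ys \<in> C)"
| "confined c (s # ss) C X a =
    (\<exists>p\<in>cylinder s. a \<le> p \<and> (\<forall>b\<in>cylinder s. p \<le> b \<longrightarrow> confined c ss C (slab X p b) b))"

lemma confined_mono:
  "confined c ss C X a \<Longrightarrow> X' \<subseteq> X \<Longrightarrow> a' \<le> a \<Longrightarrow> confined c ss C X' a'"
proof (induction ss arbitrary: X a X' a')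
  case Nil
  then show ?case by auto
next
  case (Cons s ss)
  then obtain p where p: "p \<in> cylinder s" "a \<le> p"
    and g: "\<And>b. b \<in> cylinder s \<Longrightarrow> p \<le> b \<Longrightarrow> confined c ss C (slab X p b) b"
    by auto
  have "confined c ss C (slab X' p b) b" if "b \<in> cylinder s" "p \<le> b" for b
    using Cons.IH[OF g[OF that] slab_mono[OF Cons.prems(2)]] by simp
  then show ?case
    using p Cons.prems(3) by (auto intro: order_trans)
qed

text \<open>
  Two strategies are played simultaneously by moving to the supremum of their moves.
\<close>

lemma confined_Int:
  "confined c ss C X a \<Longrightarrow> confined c ss C' X a \<Longrightarrow> confined c ss (C \<inter> C') X a"
proof (induction ss arbitrary: X a)
  case Nil
  then show ?case by auto
next
  case (Cons s ss)
  obtain p where p: "p \<in> cylinder s" "a \<le> p"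
    and g: "\<And>b. b \<in> cylinder s \<Longrightarrow> p \<le> b \<Longrightarrow> confined c ss C (slab X p b) b"
    using Cons.prems(1) by auto
  obtain p' where p': "p' \<in> cylinder s" "a \<le> p'"
    and g': "\<And>b. b \<in> cylinder s \<Longrightarrow> p' \<le> b \<Longrightarrow> confined c ss C' (slab X p' b) b"
    using Cons.prems(2) by auto
  have "confined c ss (C \<inter> C') (slab X (sup p p') b) b" if b: "b \<in> cylinder s" "sup p p' \<le> b" for b
  proof (rule Cons.IH)
    have le: "p \<le> b" "p' \<le> b" using b(2) by auto
    show "confined c ss C (slab X (sup p p') b) b"
      by (rule confined_mono[OF g[OF b(1) le(1)] slab_mono]) auto
    show "confined c ss C' (slab X (sup p p') b) b"
      by (rule confined_mono[OF g'[OF b(1) le(2)] slab_mono]) auto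
  qed
  moreover have "sup p p' \<in> cylinder s" "a \<le> sup p p'"
    using p p' by (auto simp: sup_in_cylinder intro: le_supI1)
  ultimately show ?case by auto
qed

section \<open>Making countable and finite data uniform\<close>

text \<open>
  This replaces countable directedness, which the pointwise order on \<open>nat \<Rightarrow> nat\<close> lacks: a sequence of
  functions is bounded as soon as its \<open>m\<close>-th member agrees with a fixed \<open>a\<close> below \<open>m\<close>, since then
  only finitely many members differ from \<open>a\<close> at each argument.
\<close>

lemma uniform_on_neighbourhood:
  fixes P :: "'k::countable \<Rightarrow> (nat \<Rightarrow> nat) \<Rightarrow> bool" and a :: "nat \<Rightarrow> nat"
  assumes anti: "\<And>k b b'. P k b' \<Longrightarrow> a \<le> b \<Longrightarrow> b \<le> b' \<Longrightarrow> P k b"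
    and ex: "\<And>b. a \<le> b \<Longrightarrow> \<exists>k. P k b"
  shows "\<exists>k N. \<forall>b\<ge>a. (\<forall>i<N. b i = a i) \<longrightarrow> P k b"
proof (rule ccontr)
  assume "\<not> ?thesis"
  then have "\<forall>m. \<exists>b\<ge>a. (\<forall>i<m. b i = a i) \<and> \<not> P (from_nat m) b"
    by blast
  then obtain B where B: "\<And>m. a \<le> B m" "\<And>m i. i < m \<Longrightarrow> B m i = a i"
    and bad: "\<And>m. \<not> P (from_nat m) (B m)"
    by metis
  \<comment> \<open>A bound for all \<open>B m\<close>: those with \<open>m > i\<close> take the value \<open>a i\<close> at \<open>i\<close>.\<close>
  define S where "S i = a i + (\<Sum>m\<le>i. B m i)" for i
  have "a \<le> S" by (auto simp: S_def le_fun_def)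
  then obtain k where k: "P k S" using ex by blast
  have "B (to_nat k) \<le> S"
  proof (rule le_funI)
    fix i
    show "B (to_nat k) i \<le> S i"
    proof (cases "i < to_nat k")
      case True
      then show ?thesis by (simp add: B(2) S_def)
    next
      case False
      then have "B (to_nat k) i \<le> (\<Sum>m\<le>i. B m i)"
        by (intro member_le_sum) auto
      then show ?thesis by (simp add: S_def)
    qed
  qed
  then have "P k (B (to_nat k))"
    using anti k B(1) by blast
  then show False using bad[of "to_nat k"] by simp
qed

text \<open>
  Choose \<open>b0\<close> for which the least size of an admissible set is as large as possible. Passing
  from \<open>b0\<close> to a larger \<open>b\<close> cannot increase this least size any more, so a smallest set for \<open>b0\<close> and one for
  \<open>b\<close>, both admissible for \<open>b0\<close>, coincide with their intersection.
\<close>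

lemma uniform_finite_set:
  fixes G :: "'c set \<Rightarrow> 'a::semilattice_sup \<Rightarrow> bool"
  assumes anti: "\<And>C b b'. G C b' \<Longrightarrow> b \<in> D \<Longrightarrow> b' \<in> D \<Longrightarrow> b \<le> b' \<Longrightarrow> G C b"
    and int: "\<And>C C' b. b \<in> D \<Longrightarrow> G C b \<Longrightarrow> G C' b \<Longrightarrow> G (C \<inter> C') b"
    and dir: "\<And>b b'. b \<in> D \<Longrightarrow> b' \<in> D \<Longrightarrow> sup b b' \<in> D"
    and ex: "\<And>b. b \<in> D \<Longrightarrow> \<exists>C. finite C \<and> card C \<le> \<kappa> \<and> G C b"
  shows "\<exists>C. finite C \<and> (\<forall>b\<in>D. G C b)"
proof (cases "D = {}")
  case True
  then show ?thesis by blast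
next
  case False
  define \<mu> where "\<mu> b = (LEAST k. \<exists>C. finite C \<and> card C = k \<and> G C b)" for b
  have \<mu>_le: "\<mu> b \<le> card C" if "finite C" "G C b" for b C
    unfolding \<mu>_def by (rule Least_le) (use that in blast)
  have \<mu>_ex: "\<exists>C. finite C \<and> card C = \<mu> b \<and> G C b" if b: "b \<in> D" for b
    unfolding \<mu>_def by (rule LeastI_ex) (use ex[OF b] in blast)
  have "\<mu> b < Suc \<kappa>" if "b \<in> D" for b
    using ex[OF that] \<mu>_le by (meson le_imp_less_Suc order_trans)
  then obtain b0 where b0: "b0 \<in> D" "\<And>b. b \<in> D \<Longrightarrow> \<mu> b \<le> \<mu> b0"
    using False ex_has_greatest_nat[of "\<lambda>b. b \<in> D" _ \<mu> "Suc \<kappa>"] by blast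
  obtain C0 where C0: "finite C0" "card C0 = \<mu> b0" "G C0 b0"
    using \<mu>_ex[OF b0(1)] by blast
  have "G C0 b" if b: "b \<in> D" for b
  proof -
    have D: "sup b b0 \<in> D" using dir b b0(1) by blast
    obtain C where C: "finite C" "card C = \<mu> (sup b b0)" "G C (sup b b0)"
      using \<mu>_ex[OF D] by blast
    have "G (C0 \<inter> C) b0"
      using int anti C(3) C0(3) b0(1) D by (meson sup_ge2)
    then have le: "card C0 \<le> card (C0 \<inter> C)"
      using \<mu>_le C0(1,2) by simp
    then have "C0 \<inter> C = C0"
      using C0(1) by (meson Int_lower1 card_seteq)
    moreover have "C0 \<inter> C = C"
      using le C b0(2)[OF D] C0(2) by (intro card_seteq) auto
    ultimately show ?thesis
      using anti[OF C(3) b D] by simp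
  qed
  then show ?thesis using C0(1) by blast
qed

section \<open>Confining the colours\<close>

text \<open>
  Induction on the number \<open>m\<close> of rounds that remain. For each bound \<open>b \<ge> a\<close> the induction hypothesis
  applies to the ladder extended by the interval \<open>[a, b]\<close>; the two uniformity
  lemmas then remove the dependence on \<open>b\<close>, for all \<open>b\<close> that agree with \<open>a\<close> on an initial part
  \<open>s\<close>. The winning first move is \<open>a\<close> itself.
\<close>

lemma ladder_confined:
  assumes fin: "\<And>X a. ladder n X a \<Longrightarrow> finite (c ` X)"
  shows "ladder j X a \<Longrightarrow> j + m = n \<Longrightarrow> \<exists>ss C. length ss = m \<and> finite C \<and> confined c ss C X a"
proof (induction m arbitrary: j X a)
  case 0
  then have "finite (c ` X)"
    using fin by simp
  then show ?case by (intro exI[of _ "[]"] exI[of _ "c ` X"]) simp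
next
  case (Suc m)
  define P where "P = (\<lambda>(ss, \<kappa>) b. length ss = m \<and>
      (\<exists>C. finite C \<and> card C \<le> \<kappa> \<and> confined c ss C (slab X a b) b))"
  have "\<exists>k N. \<forall>b\<ge>a. (\<forall>i<N. b i = a i) \<longrightarrow> P k b"
  proof (rule uniform_on_neighbourhood)
    fix k b b' assume "P k b'" "a \<le> b" "b \<le> b'"
    then show "P k b"
      unfolding P_def by (auto split: prod.splits intro: confined_mono[OF _ slab_mono])
  next
    fix b assume ab: "a \<le> b"
    obtain ss C where "length ss = m" "finite C" "confined c ss C (slab X a b) b"
      using Suc.IH[OF ladder_step[OF Suc.prems(1) ab]] Suc.prems(2) by auto
    then have "P (ss, card C) b" unfolding P_def by auto
    then show "\<exists>k. P k b" ..
  qed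
  then obtain ss \<kappa> N where P: "\<And>b. a \<le> b \<Longrightarrow> (\<forall>i<N. b i = a i) \<Longrightarrow> P (ss, \<kappa>) b"
    by auto
  define s where "s = map a [0..<N]"
  have cylinder_iff: "b \<in> cylinder s \<longleftrightarrow> (\<forall>i<N. b i = a i)" for b
    by (auto simp: cylinder_def s_def)
  have len: "length ss = m" using P[of a] by (auto simp: P_def)
  have "\<exists>C. finite C \<and> (\<forall>b\<in>{b. a \<le> b \<and> b \<in> cylinder s}. confined c ss C (slab X a b) b)"
  proof (rule uniform_finite_set)
    fix C b b' assume "confined c ss C (slab X a b') b'" "b \<le> b'"
    then show "confined c ss C (slab X a b) b"
      by (auto intro: confined_mono[OF _ slab_mono])
  next
    fix b assume "b \<in> {b. a \<le> b \<and> b \<in> cylinder s}"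
    then show "\<exists>C. finite C \<and> card C \<le> \<kappa> \<and> confined c ss C (slab X a b) b"
      using P[of b] by (auto simp: cylinder_iff P_def)
  qed (auto simp: confined_Int sup_in_cylinder intro: le_supI1)
  then obtain C where C: "finite C"
    "\<And>b. b \<in> cylinder s \<Longrightarrow> a \<le> b \<Longrightarrow> confined c ss C (slab X a b) b"
    by auto
  have "confined c (s # ss) C X a"
    using C(2) by (auto simp: cylinder_iff intro!: bexI[of _ a])
  then show ?case
    using len C(1) by (metis length_Cons)
qed

text \<open>
  One run of the game in which the second player always repeats the move of the first.
\<close>

lemma confined_play:
  "confined c ss C X a \<Longrightarrow> xs \<in> X \<Longrightarrow>
    \<exists>ys. length ys = length ss \<and> (\<forall>y\<in>set ys. a \<le> y) \<and> c (ys @ xs) \<in> C"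
proof (induction ss arbitrary: X a xs)
  case Nil
  then show ?case by auto
next
  case (Cons s ss)
  then obtain p where p: "p \<in> cylinder s" "a \<le> p" "confined c ss C (slab X p p) p"
    by auto
  have "p # xs \<in> slab X p p" using Cons.prems(2) by (auto simp: slab_def)
  from Cons.IH[OF p(3) this] obtain ys
    where ys: "length ys = length ss" "\<forall>y\<in>set ys. p \<le> y" "c (ys @ p # xs) \<in> C"
    by blast
  then show ?case
    using p(2) by (intro exI[of _ "ys @ [p]"]) (auto intro: order_trans)
qed

text \<open>
  The list \<open>s\<close> restricts the first bound \<open>b\<close> only below column \<open>length s\<close>, so \<open>b\<close> may
  be arbitrarily large there, and all later entries lie above it.
\<close>

lemma confined_play_above:
  assumes "confined c (s # ss) C {[]} a"
  shows "\<exists>w. length w = Suc (length ss) \<and> (\<forall>y\<in>set w. v < y (length s)) \<and> c w \<in> C"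
proof -
  obtain p where p: "p \<in> cylinder s"
    and g: "\<And>b. b \<in> cylinder s \<Longrightarrow> p \<le> b \<Longrightarrow> confined c ss C (slab {[]} p b) b"
    using assms by auto
  define b where "b = p(length s := Suc (p (length s) + v))"
  have b: "b \<in> cylinder s" "p \<le> b" "v < b (length s)"
    using p by (auto simp: b_def cylinder_def le_fun_def)
  have "[b] \<in> slab {[]} p b" using b(2) by (auto simp: slab_def)
  from confined_play[OF g[OF b(1,2)] this] obtain ys
    where ys: "length ys = length ss" "\<forall>y\<in>set ys. b \<le> y" "c (ys @ [b]) \<in> C"
    by blast
  have "v < y (length s)" if "y \<in> set (ys @ [b])" for y
    using that ys(2) b(3) by (auto dest!: bspec le_funD[where x = "length s"])
  then show ?thesis
    using ys by (intro exI[of _ "ys @ [b]"]) auto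
qed

section \<open>The infinitary Sperner lemma\<close>

theorem theorem6p1:
  fixes n :: nat and \<phi> :: "(nat \<Rightarrow> int) \<Rightarrow> (nat \<Rightarrow> int)"
  assumes "n \<ge> 1" and "sperner_colouring n \<phi>"
  shows "\<exists>\<sigma>\<in>seqs n. infinite (\<phi> ` cube n \<sigma>)"
proof (rule ccontr)
  assume "\<not> ?thesis"
  then have cubes: "\<And>\<sigma>. \<sigma> \<in> seqs n \<Longrightarrow> finite (\<phi> ` cube n \<sigma>)"
    by blast
  define c where "c ys = \<phi> (subgraph_count ys)" for ys
  have "finite (c ` X)" if lad: "ladder n X a" for X a
  proof -
    obtain \<sigma> where \<sigma>: "\<sigma> \<in> seqs n" "subgraph_count ` X \<subseteq> cube n \<sigma>"
      using ladder_subset_cube[OF lad] by blast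
    then have "c ` X \<subseteq> \<phi> ` cube n \<sigma>" by (auto simp: c_def)
    then show ?thesis using cubes[OF \<sigma>(1)] by (rule finite_subset)
  qed
  then obtain ss0 C where ss0: "length ss0 = n" and C: "finite C" "confined c ss0 C {[]} (\<lambda>_. 0)"
    using ladder_confined[OF _ ladder_Nil, of n c n] by auto
  obtain s ss where ss: "ss0 = s # ss" using ss0 assms(1) by (cases ss0) auto
  define i where "i = length s"
  have "\<exists>w. length w = n \<and> (\<forall>y\<in>set w. v < y i) \<and> c w \<in> C" for v
    using confined_play_above[OF C(2)[unfolded ss], of v] ss0 ss by (simp add: i_def)
  then obtain w where w: "\<And>v. length (w v) = n" "\<And>v y. y \<in> set (w v) \<Longrightarrow> v < y i"
    "\<And>v. c (w v) \<in> C"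
    by metis
  have "finite (range (\<lambda>v. c (w v)))"
    using C(1) w(3) by (meson finite_subset image_subsetI)
  then obtain v0 where v0: "infinite {v. c (w v) = c (w v0)}"
    using pigeonhole_infinite[of UNIV "\<lambda>v. c (w v)"] by auto
  \<comment> \<open>An upper bound for the entries of \<open>w v0\<close> in column \<open>i\<close>, above which another tuple
      of the same colour is taken.\<close>
  define h where "h = (\<Sum>y\<leftarrow>w v0. y i)"
  have h: "y i \<le> h" if "y \<in> set (w v0)" for y
    unfolding h_def using that by (intro member_le_sum_list) auto
  obtain v where v: "h \<le> v" "c (w v) = c (w v0)"
    using v0 unfolding infinite_nat_iff_unbounded_le by auto
  have "subgraph_count (w v) (prod_encode (i, h)) = int n"
    using w(2)[of _ v] v(1) w(1)[of v] by (subst subgraph_count_eq_length) (auto intro: order_le_less_trans)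
  moreover have "subgraph_count (w v0) (prod_encode (i, h)) = 0"
    using h by (rule subgraph_count_eq_0)
  ultimately have "seq_dist (subgraph_count (w v)) (subgraph_count (w v0)) = int n"
    using w(1) by (intro seq_dist_eq_max[where i = "prod_encode (i, h)"] subgraph_count_in_seqs) auto
  then have "\<phi> (subgraph_count (w v)) \<noteq> \<phi> (subgraph_count (w v0))"
    using assms(2) subgraph_count_in_seqs[OF w(1)] unfolding sperner_colouring_def by blast
  then show False using v(2) by (simp add: c_def)
qed

end
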